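(* Let $A=U\Sigma_r V^T$ be the compact singular value decomposition of $A$ (so $U\in\mathbb{R}^{m\times r}$ has orthonormal columns, $\Sigma_r\in\mathcal{S}^r$ is diagonal and positive definite, $V\in\mathbb{R}^{r\times r}$ is orthogonal). Let $P\in\mathbb{R}^{(n+m)\times r}$ and $\bar Y\in\mathcal{S}^{n+m}$ be partitioned as $$P=\begin{pmatrix}P_1\\ P_2\end{pmatrix},\qquad \bar Y=\begin{pmatrix}\bar Y_{11}&\bar Y_{21}^T\\ \bar Y_{21}&\bar Y_{22}\end{pmatrix},$$ with $P_1\in\mathbb{R}^{n\times r}$, $P_2\in\mathbb{R}^{m\times r}$, $\bar Y_{11}\in\mathcal{S}^n$, $\bar Y_{22}\in\mathcal{S}^m$. Put $G(P,\bar Y):=PP^T-\bar Y$ (the same formula being used for $G$ on spaces of other dimensions, e.g. $G(X,Y)=XX^T-Y$ for $X\in\mathbb{R}^{n\times r}$, $Y\in\mathcal{S}^n$), and let $$\mathcal{F}_G=\{(P,\bar Y): G(P,\bar Y)\preceq 0,\ \bar Y_{22}=AA^T,\ P_2=A\}.$$ Then $\mathcal{F}_G$ is equal to each of the following sets, in which $X\in\mathbb{R}^{n\times r}$, $Y\in\mathcal{S}^n$, and $Z=\begin{pmatrix}Z_{11}&Z_{21}^T\\ Z_{21}&Z_{22}\end{pmatrix}\in\mathcal{S}^{n+r}$ (with $Z_{11}\in\mathcal{S}^n$, $Z_{22}\in\mathcal{S}^r$) are existentially quantified: 1. $\left\{(P,\bar Y): G(X,Y)\preceq 0,\ \bar Y_{11}=Y,\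 \bar Y_{21}=AX^T,\ \bar Y_{22}=AA^T,\ P=\begin{pmatrix}X\\ A\end{pmatrix}\right\}$; 2. $\left\{(P,\bar Y): Z\succeq 0,\ \bar Y=\begin{pmatrix}I_n&0\\0&A\end{pmatrix}Z\begin{pmatrix}I_n&0\\0&A\end{pmatrix}^T,\ Z_{22}=I,\ X=Z_{21}^T,\ P=\begin{pmatrix}X\\ A\end{pmatrix}\right\}$; 3. $\left\{(P,\bar Y): \bar Y\succeq 0,\ \bar Y_{22}=AA^T,\ X=\bar Y_{21}^TA(A^TA)^{-1},\ P=\begin{pmatrix}X\\ A\end{pmatrix}\right\}$; 4. $\left\{(P,\bar Y): Z\succeq 0,\ \bar Y=\begin{pmatrix}I_n&0\\0&U\end{pmatrix}Z\begin{pmatrix}I_n&0\\0&U\end{pmatrix}^T,\ Z_{22}=\Sigma_r^2,\ X=\bar Y_{21}^TA(A^TA)^{-1}=Z_{21}^T\Sigma_r^{-1}V^T,\ P=\begin{pmatrix}X\\ A\end{pmatrix}\right\}$. Moreover, the function $G$ is convex in the Löwner (semidefinite) partial order, and $\mathcal{F}_G$ is a closed convex set.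
   Context: $\mathcal{S}^k$ denotes the space of real symmetric $k\times k$ matrices. $M\succeq 0$ means that $M$ is symmetric positive semidefinite, and $M\preceq N$ means $N-M\succeq 0$ (Löwner order). $I_k$ (or $I$) is the identity matrix. There are $n$ unknown points (sensors) and $m$ known points (anchors) in $\mathbb{R}^r$. The rows of $A\in\mathbb{R}^{m\times r}$ are the anchors, and the rows of $X\in\mathbb{R}^{n\times r}$ are the sensors. Standing assumption: $n\gg m>r$, $A^Te=0$ (where $e$ is the vector of ones), and $A$ has full column rank $r$. *)

theory Defs
  imports "HOL-Analysis.Analysis"
begin

(* real^'c^'k is the space of matrices with rows indexed by 'k and columns by 'c;
   a partition of the rows (columns) into two groups is indexing by a sum type. *)

definition sym_mats :: "(real^'k^'k) set" where
  "sym_mats = {M. transpose M = M}"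

definition psd :: "real^'k^'k \<Rightarrow> bool" where
  "psd M \<longleftrightarrow> M \<in> sym_mats \<and> (\<forall>x. 0 \<le> x \<bullet> (M *v x))"

definition pos_def :: "real^'k^'k \<Rightarrow> bool" where
  "pos_def M \<longleftrightarrow> M \<in> sym_mats \<and> (\<forall>x. x \<noteq> 0 \<longrightarrow> 0 < x \<bullet> (M *v x))"

definition is_diagonal :: "real^'k^'k \<Rightarrow> bool" where
  "is_diagonal M \<longleftrightarrow> (\<forall>i j. i \<noteq> j \<longrightarrow> M $ i $ j = 0)"

definition loewner_le :: "real^'k^'k \<Rightarrow> real^'k^'k \<Rightarrow> bool" (infix "\<preceq>" 50) where
  "M \<preceq> N \<longleftrightarrow> psd (N - M)"

definition loewner_convex_on ::
    "'a::real_vector set \<Rightarrow> ('a \<Rightarrow> real^'k^'k) \<Rightarrow> bool" where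
  "loewner_convex_on S f \<longleftrightarrow> convex S \<and>
     (\<forall>x\<in>S. \<forall>y\<in>S. \<forall>u\<ge>0. \<forall>v\<ge>0. u + v = 1 \<longrightarrow>
        f (u *\<^sub>R x + v *\<^sub>R y) \<preceq> u *\<^sub>R f x + v *\<^sub>R f y)"

definition bot_rows :: "'a^'c^('k::finite + 'l::finite) \<Rightarrow> 'a^'c^'l" where
  "bot_rows P = (\<chi> i. P $ Inr i)"

definition stack_rows :: "'a^'c^'k \<Rightarrow> 'a^'c^'l \<Rightarrow> 'a^'c^('k::finite + 'l::finite)" where
  "stack_rows X A = (\<chi> i. case i of Inl p \<Rightarrow> X $ p | Inr q \<Rightarrow> A $ q)"

(* No (1,2) block is needed: for symmetric M it is the transpose of block21 M. *)
definition block11 :: "'a^('k::finite + 'l::finite)^('k + 'l) \<Rightarrow> 'a^'k^'k" where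
  "block11 M = (\<chi> i j. M $ Inl i $ Inl j)"

definition block21 :: "'a^('k::finite + 'l::finite)^('k + 'l) \<Rightarrow> 'a^'k^'l" where
  "block21 M = (\<chi> i j. M $ Inr i $ Inl j)"

definition block22 :: "'a^('k::finite + 'l::finite)^('k + 'l) \<Rightarrow> 'a^'l^'l" where
  "block22 M = (\<chi> i j. M $ Inr i $ Inr j)"

definition block_diag ::
    "real^'c^'k \<Rightarrow> real^'d^'l \<Rightarrow> real^('c::finite + 'd::finite)^('k::finite + 'l::finite)" where
  "block_diag B C = (\<chi> i j. case (i, j) of
       (Inl p, Inl q) \<Rightarrow> B $ p $ q
     | (Inr p, Inr q) \<Rightarrow> C $ p $ q
     | _ \<Rightarrow> 0)"

definition compact_svd ::
    "real^'r^'m \<Rightarrow> real^'r^'m \<Rightarrow> real^'r^'r \<Rightarrow> real^'r^'r \<Rightarrow> bool" where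
  "compact_svd A U \<Sigma> V \<longleftrightarrow>
     A = U ** \<Sigma> ** transpose V \<and> transpose U ** U = mat 1 \<and>
     is_diagonal \<Sigma> \<and> pos_def \<Sigma> \<and> orthogonal_matrix V"

(* The row index type is left generic, since the formula is used both for
   (P, Ybar), with rows indexed by 'n + 'm, and for (X, Y), with rows indexed by 'n. *)
definition G :: "real^'r^'k \<Rightarrow> real^'k^'k \<Rightarrow> real^'k^'k" where
  "G P Y = P ** transpose P - Y"

definition feasible_G :: "real^'r^'m \<Rightarrow>
    ((real^'r^('n::finite + 'm::finite)) \<times> (real^('n + 'm)^('n + 'm))) set" where
  "feasible_G A = {(P, Y). Y \<in> sym_mats \<and> G P Y \<preceq> 0 \<and>
     block22 Y = A ** transpose A \<and> bot_rows P = A}"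

end

theory Submission
  imports Defs
begin

text \<open>If the lower right block of \<open>Y - P P\<^sup>T\<close> vanishes, semidefiniteness forces the off-diagonal block
  to vanish as well and leaves only the upper left block; this reduces \<open>\<F>\<close> to the pairs \<open>(X, Y)\<close>.
  Conversely, a positive semidefinite \<open>Y\<close> with lower right block \<open>A A\<^sup>T\<close> has an off-diagonal block
  that annihilates the kernel of \<open>A\<^sup>T\<close>, hence equals \<open>A X\<^sup>T\<close> with \<open>X\<close> given by the pseudoinverse
  of \<open>A\<close>. Convexity follows from the identity
  \<open>u G(P,Y) + v G(Q,W) - G(u P + v Q, u Y + v W) = u v (P - Q)(P - Q)\<^sup>T\<close> for \<open>u + v = 1\<close>.\<close>

subsection \<open>Positive semidefinite matrices\<close>

lemma sym_matsD: "M \<in> sym_mats \<Longrightarrow> transpose M = M"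
  by (simp add: sym_mats_def)

lemma mem_sym_mats_iff: "M \<in> sym_mats \<longleftrightarrow> (\<forall>i j. M $ i $ j = M $ j $ i)"
  by (auto simp: sym_mats_def transpose_def vec_eq_iff)

lemma psd_sym: "psd M \<Longrightarrow> M \<in> sym_mats"
  by (simp add: psd_def)

lemma inner_matrix_vector_transpose:
  fixes M :: "real^'k^'l"
  shows "x \<bullet> (M *v y) = (transpose M *v x) \<bullet> y"
  by (metis dot_lmul_matrix transpose_matrix_vector)

text \<open>The quadratic form of the product at \<open>x\<close> is that of \<open>M\<close> at
  \<open>transpose D *v x\<close>.\<close>

lemma psd_congruence:
  fixes M :: "real^'k^'k" and D :: "real^'k^'l"
  assumes "psd M"
  shows "psd (D ** M ** transpose D)"
proof -
  have "transpose (D ** M ** transpose D) = D ** M ** transpose D"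
    using assms by (simp add: matrix_transpose_mul matrix_mul_assoc psd_def sym_mats_def)
  moreover have "x \<bullet> ((D ** M ** transpose D) *v x) = (transpose D *v x) \<bullet> (M *v (transpose D *v x))" for x
    by (metis inner_matrix_vector_transpose matrix_vector_mul_assoc)
  ultimately show ?thesis
    using assms by (simp add: psd_def sym_mats_def)
qed

lemma psd_mat_1: "psd (mat 1)"
  by (simp add: psd_def sym_mats_def transpose_mat)

lemma psd_mult_transpose: "psd (P ** transpose P)"
  using psd_congruence[OF psd_mat_1, of P] by simp

lemma sym_mats_mult_transpose: "P ** transpose P \<in> sym_mats"
  by (rule psd_sym[OF psd_mult_transpose])

lemma subspace_sym_mats: "subspace sym_mats"
  by (auto simp: subspace_def mem_sym_mats_iff)

lemma psd_add: "psd M \<Longrightarrow> psd N \<Longrightarrow> psd (M + N)"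
  by (auto simp: psd_def subspace_add[OF subspace_sym_mats] matrix_vector_mult_add_rdistrib inner_add_right)

lemma psd_scaleR:
  assumes "0 \<le> c" "psd M"
  shows "psd (c *\<^sub>R M)"
proof -
  have "c *\<^sub>R M \<in> sym_mats"
    using assms by (intro subspace_scale subspace_sym_mats) (simp add: psd_def)
  moreover have "0 \<le> x \<bullet> (c *\<^sub>R M *v x)" for x
    using assms by (simp add: psd_def flip: scaleR_matrix_vector_assoc)
  ultimately show ?thesis
    by (simp add: psd_def)
qed

text \<open>Put y = M x. Along the line y + t x the quadratic term in t vanishes, so the form is
  affine in t with slope 2 (y . y). A nonzero slope would make it negative somewhere.\<close>

lemma psd_quadratic_form_zero:
  assumes "psd M" and "x \<bullet> (M *v x) = 0"
  shows "M *v x = 0"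
proof (rule ccontr)
  assume "M *v x \<noteq> 0"
  define y where "y = M *v x"
  have yy: "y \<bullet> y > 0"
    using \<open>M *v x \<noteq> 0\<close> by (simp add: y_def)
  have sym: "x \<bullet> (M *v y) = y \<bullet> y"
    using assms(1) by (metis inner_matrix_vector_transpose psd_sym sym_matsD y_def)
  \<comment> \<open>Solves y . M y + 2 t (y . y) = -1.\<close>
  define t where "t = - (y \<bullet> (M *v y) + 1) / (2 * (y \<bullet> y))"
  have "0 \<le> (y + t *\<^sub>R x) \<bullet> (M *v (y + t *\<^sub>R x))"
    using assms(1) by (simp add: psd_def)
  also have "\<dots> = y \<bullet> (M *v y) + 2 * t * (y \<bullet> y)"
    using assms(2) sym
    by (simp add: matrix_vector_right_distrib matrix_vector_mult_scaleR inner_add_left inner_add_right flip: y_def)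
  also have "\<dots> = - 1"
    using yy by (simp add: t_def field_simps)
  finally show False
    by simp
qed

lemma closed_sym_mats: "closed (sym_mats :: (real^'k^'k) set)"
  by (rule closed_subspace[OF subspace_sym_mats])

text \<open>For each fixed \<open>x\<close> the form is linear in \<open>M\<close>, so the cone is
  an intersection of a subspace with closed half-spaces.\<close>

lemma closed_psd: "closed {M :: real^'k^'k. psd M}"
proof -
  have "{M :: real^'k^'k. psd M} = sym_mats \<inter> (\<Inter>x. {M. 0 \<le> x \<bullet> (M *v x)})"
    by (auto simp: psd_def)
  moreover have "closed {M :: real^'k^'k. 0 \<le> x \<bullet> (M *v x)}" for x
    by (intro closed_Collect_le continuous_intros)
      (auto simp: matrix_vector_mult_def intro!: continuous_intros)
  ultimately show ?thesis
    by (simp add: closed_Int closed_INT closed_sym_mats)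
qed


subsection \<open>Invertibility\<close>

lemma invertible_of_kernel:
  fixes M :: "real^'k^'k"
  assumes "\<And>x. M *v x = 0 \<Longrightarrow> x = 0"
  shows "invertible M"
  using assms by (simp add: invertible_left_inverse matrix_left_invertible_ker)

lemma matrix_inv_cancel:
  fixes M :: "real^'k^'k"
  assumes "invertible M"
  shows "M ** matrix_inv M = mat 1" "matrix_inv M ** M = mat 1"
  using someI_ex[OF assms[unfolded invertible_def]] by (simp_all add: matrix_inv_def)

lemma pos_def_invertible: "pos_def M \<Longrightarrow> invertible M"
  by (rule invertible_of_kernel) (force simp: pos_def_def)

text \<open>A kernel vector x of the Gram matrix has |A x|^2 = 0, and full column rank makes
  \<open>A\<close> injective.\<close>

lemma invertible_gram:
  fixes A :: "real^'r^'m"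
  assumes "rank A = CARD('r)"
  shows "invertible (transpose A ** A)"
proof (rule invertible_of_kernel)
  fix x assume "(transpose A ** A) *v x = 0"
  then have "(A *v x) \<bullet> (A *v x) = 0"
    by (simp add: inner_matrix_vector_transpose matrix_vector_mul_assoc)
  then have "A *v x = A *v 0"
    by simp
  then show "x = 0"
    using assms by (simp only: full_rank_injective inj_eq)
qed

text \<open>Recovers \<open>X\<close> from the transpose of the off-diagonal block
  \<open>A ** transpose X\<close>.\<close>

lemma gram_inv_cancel:
  fixes A :: "real^'r^'m"
  assumes "rank A = CARD('r)"
  shows "X ** transpose A ** A ** matrix_inv (transpose A ** A) = X"
  using matrix_inv_cancel(1)[OF invertible_gram[OF assms]] by (simp flip: matrix_mul_assoc)

text \<open>\<open>A ** matrix_inv (transpose A ** A)\<close> is a right inverse of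
  \<open>transpose A\<close>.\<close>

lemma full_rank_transpose_preimage:
  fixes A :: "real^'r^'m"
  assumes "rank A = CARD('r)"
  obtains w where "transpose A *v w = y"
proof
  show "transpose A *v (A *v (matrix_inv (transpose A ** A) *v y)) = y"
    using matrix_inv_cancel[OF invertible_gram[OF assms]]
    by (simp add: matrix_vector_mul_assoc matrix_mul_assoc)
qed


subsection \<open>Block matrices\<close>

lemma sum_UNIV_sum_type:
  "sum f (UNIV :: ('a::finite + 'b::finite) set) = (\<Sum>i\<in>UNIV. f (Inl i)) + (\<Sum>i\<in>UNIV. f (Inr i))"
  by (simp flip: UNIV_Plus_UNIV add: sum.Plus)

definition join_vec :: "'a^'k \<Rightarrow> 'a^'l \<Rightarrow> 'a^('k::finite + 'l::finite)" where
  "join_vec x y = (\<chi> i. case i of Inl p \<Rightarrow> x $ p | Inr q \<Rightarrow> y $ q)"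

text \<open>The upper right block is filled with \<open>transpose C\<close>, so on symmetric
  matrices this inverts the extraction of \<open>block11\<close>, \<open>block21\<close> and
  \<open>block22\<close>.\<close>

definition sym_block :: "'a^'k^'k \<Rightarrow> 'a^'k^'l \<Rightarrow> 'a^'l^'l \<Rightarrow> 'a^('k::finite + 'l::finite)^('k + 'l)" where
  "sym_block B C D = stack_rows (\<chi> i. join_vec (B $ i) (transpose C $ i)) (\<chi> i. join_vec (C $ i) (D $ i))"

lemma sum_vec_cases: obtains a b where "z = join_vec a b"
proof
  show "z = join_vec (\<chi> i. z $ Inl i) (\<chi> i. z $ Inr i)"
    by (simp add: join_vec_def vec_eq_iff split: sum.split)
qed

lemma join_vec_eq_0_iff [simp]: "join_vec a b = 0 \<longleftrightarrow> a = 0 \<and> b = 0"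
  by (simp add: join_vec_def vec_eq_iff split_sum_all)

lemma join_vec_inner: "join_vec a b \<bullet> join_vec c d = a \<bullet> c + b \<bullet> d"
  by (simp add: inner_vec_def join_vec_def sum_UNIV_sum_type)

lemma block_sym_block [simp]:
  "block11 (sym_block B C D) = B"
  "block21 (sym_block B C D) = C"
  "block22 (sym_block B C D) = D"
  by (simp_all add: block11_def block21_def block22_def sym_block_def stack_rows_def join_vec_def vec_eq_iff)

lemma sym_block_blocks:
  assumes "M \<in> sym_mats"
  shows "sym_block (block11 M) (block21 M) (block22 M) = M"
  using assms
  by (auto simp: block11_def block21_def block22_def sym_block_def stack_rows_def join_vec_def
      transpose_def vec_eq_iff mem_sym_mats_iff split: sum.split)

lemma sym_mats_sym_block [simp]:
  "sym_block B C D \<in> sym_mats \<longleftrightarrow> B \<in> sym_mats \<and> D \<in> sym_mats"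
  by (auto simp: mem_sym_mats_iff sym_block_def stack_rows_def join_vec_def transpose_def
      split: sum.split sum.split_asm)

lemma sym_block_mult_join_vec:
  "sym_block B C D *v join_vec x y = join_vec (B *v x + transpose C *v y) (C *v x + D *v y)"
  by (simp add: vec_eq_iff matrix_vector_mult_def sym_block_def stack_rows_def join_vec_def
      sum_UNIV_sum_type split: sum.split)

lemma bot_rows_stack_rows [simp]: "bot_rows (stack_rows X A) = A"
  by (simp add: bot_rows_def stack_rows_def vec_eq_iff)

lemma stack_rows_cases: obtains X where "P = stack_rows X (bot_rows P)"
proof
  show "P = stack_rows (\<chi> i. P $ Inl i) (bot_rows P)"
    by (simp add: bot_rows_def stack_rows_def vec_eq_iff split: sum.split)
qed

lemma stack_rows_mult_transpose:
  fixes X :: "real^'r^'k" and A :: "real^'r^'l"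
  shows
  "stack_rows X A ** transpose (stack_rows X A) =
    sym_block (X ** transpose X) (A ** transpose X) (A ** transpose A)"
  by (simp add: vec_eq_iff matrix_matrix_mult_def stack_rows_def sym_block_def join_vec_def
      transpose_def split: sum.split) (simp add: mult.commute[of "X $ _ $ _"])

lemma sym_block_diff: "sym_block B C D - sym_block B' C' D' = sym_block (B - B') (C - C') (D - D')"
  by (simp add: vec_eq_iff stack_rows_def sym_block_def join_vec_def
      transpose_def split: sum.split)

text \<open>Symmetry of \<open>Z\<close> makes its upper right block the transpose of
  \<open>block21 Z\<close>, as the form of \<open>sym_block\<close> requires.\<close>

lemma block_diag_congruence:
  assumes "Z \<in> sym_mats"
  shows "block_diag (mat 1) B ** Z ** transpose (block_diag (mat 1) B) =
    sym_block (block11 Z) (B ** block21 Z) (B ** block22 Z ** transpose B)"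
proof -
  have "Z $ i $ j = Z $ j $ i" for i j
    using assms by (simp add: mem_sym_mats_iff)
  then show ?thesis
    by (simp add: vec_eq_iff matrix_matrix_mult_def block_diag_def stack_rows_def sym_block_def join_vec_def
      block11_def block21_def block22_def sum_UNIV_sum_type mat_def if_distrib if_distribR
      transpose_def cong: if_cong split: sum.split) (simp add: mult.commute)
qed

text \<open>Vectors (0, w) have zero quadratic form, hence lie in the kernel; the upper part of
  their image is \<open>transpose C *v w\<close>.\<close>

lemma psd_sym_block_zero:
  "psd (sym_block B C 0) \<longleftrightarrow> psd B \<and> C = 0"
proof
  assume psd: "psd (sym_block B C 0)"
  have "transpose C *v w = 0" for w
    using psd_quadratic_form_zero[OF psd, of "join_vec 0 w"]
    by (simp add: sym_block_mult_join_vec join_vec_inner)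
  then have "transpose C = 0"
    by (simp add: matrix_eq)
  then have "C = 0"
    by (simp add: transpose_def vec_eq_iff)
  moreover have "0 \<le> x \<bullet> (B *v x)" for x
  proof -
    have "0 \<le> join_vec x 0 \<bullet> (sym_block B C 0 *v join_vec x 0)"
      using psd by (simp add: psd_def)
    then show ?thesis
      by (simp add: sym_block_mult_join_vec join_vec_inner)
  qed
  ultimately show "psd B \<and> C = 0"
    using psd by (simp add: psd_def)
next
  assume "psd B \<and> C = 0"
  moreover have "0 \<in> sym_mats"
    by (rule subspace_0[OF subspace_sym_mats])
  moreover have "0 \<le> z \<bullet> (sym_block B C 0 *v z)" if "psd B" "C = 0" for z
    using that by (cases z rule: sum_vec_cases)
      (simp add: sym_block_mult_join_vec join_vec_inner psd_def)
  ultimately show "psd (sym_block B C 0)"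
    by (simp add: psd_def)
qed


subsection \<open>The map G\<close>

lemma G_le_zero_iff: "G P Y \<preceq> 0 \<longleftrightarrow> psd (Y - P ** transpose P)"
  by (simp add: G_def loewner_le_def)

text \<open>Y is the sum of Y - P P^T and P P^T.\<close>

lemma G_le_zero_imp_psd: "G P Y \<preceq> 0 \<Longrightarrow> psd Y"
  using psd_add[OF _ psd_mult_transpose, of "Y - P ** transpose P" P] by (simp add: G_le_zero_iff)

text \<open>The lower right blocks of Y and P P^T cancel, leaving a matrix with a zero
  corner.\<close>

lemma G_stack_rows_le_zero_iff:
  "G (stack_rows X Q) (sym_block Y C (Q ** transpose Q)) \<preceq> 0 \<longleftrightarrow> G X Y \<preceq> 0 \<and> C = Q ** transpose X"
  by (simp add: G_le_zero_iff stack_rows_mult_transpose sym_block_diff psd_sym_block_zero)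

lemma psd_block22_gram_factor:
  fixes A :: "real^'r^'m"
  assumes "psd (sym_block Y C (A ** transpose A))" and rank: "rank A = CARD('r)"
  shows "C = A ** transpose (transpose C ** A ** matrix_inv (transpose A ** A))"
proof -
  let ?N = "matrix_inv (transpose A ** A)"
  note inv = matrix_inv_cancel[OF invertible_gram[OF rank]]
  \<comment> \<open>Such a (0, w) has zero quadratic form, because the lower block contributes |A^T
    w|^2.\<close>
  have ker: "transpose C *v w = 0" if "transpose A *v w = 0" for w
    using psd_quadratic_form_zero[OF assms(1), of "join_vec 0 w"] that
    by (simp add: sym_block_mult_join_vec join_vec_inner flip: matrix_vector_mul_assoc)
  have "transpose C *v w = (transpose C ** A ** ?N ** transpose A) *v w" for w
  proof -
    \<comment> \<open>\<open>A ** ?N ** transpose A\<close> is the orthogonal projection onto the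
      range of \<open>A\<close>; the residual of \<open>w\<close> lies in the kernel of
      \<open>transpose A\<close>.\<close>
    have "transpose A *v (w - (A ** ?N ** transpose A) *v w) = 0"
      using inv by (simp add: matrix_vector_mult_diff_distrib matrix_vector_mul_assoc matrix_mul_assoc)
    from ker[OF this] show ?thesis
      by (simp add: matrix_vector_mult_diff_distrib matrix_vector_mul_assoc matrix_mul_assoc)
  qed
  then have "transpose C = transpose C ** A ** ?N ** transpose A"
    by (simp add: matrix_eq)
  then have "transpose (transpose C) = transpose (transpose C ** A ** ?N ** transpose A)"
    by (rule arg_cong)
  also have "\<dots> = A ** transpose (transpose C ** A ** ?N)"
    by (simp add: matrix_transpose_mul)
  finally show ?thesis
    by (simp only: transpose_transpose)
qed

text \<open>Minimising the quadratic form of the block matrix over its second argument \<open>w\<close> leaves the Schur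
  complement; since the lower block factors through \<open>A\<close>, the minimum is reached when
  \<open>A\<^sup>T w = - X\<^sup>T x\<close>.\<close>

lemma psd_imp_G_le_zero:
  fixes A :: "real^'r^'m"
  assumes psd: "psd (sym_block Y (A ** transpose X) (A ** transpose A))"
    and rank: "rank A = CARD('r)"
  shows "G X Y \<preceq> 0"
proof -
  have Y: "Y \<in> sym_mats"
    using psd_sym[OF psd] by simp
  have "0 \<le> x \<bullet> ((Y - X ** transpose X) *v x)" for x
  proof -
    obtain w where w: "transpose A *v w = - (transpose X *v x)"
      using full_rank_transpose_preimage[OF rank] by blast
    let ?v = "transpose X *v x"
    have "0 \<le> join_vec x w \<bullet> (sym_block Y (A ** transpose X) (A ** transpose A) *v join_vec x w)"
      using psd by (simp add: psd_def)
    also have "\<dots> = x \<bullet> (Y *v x) + x \<bullet> (X *v (transpose A *v w)) + w \<bullet> (A *v ?v) + w \<bullet> (A *v (transpose A *v w))"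
      by (simp add: sym_block_mult_join_vec join_vec_inner inner_add_right matrix_transpose_mul
          flip: matrix_vector_mul_assoc)
    \<comment> \<open>By the choice of \<open>w\<close>, each cross term equals -|v|^2 and the last
      term equals |v|^2.\<close>
    also have "\<dots> = x \<bullet> (Y *v x) - ?v \<bullet> ?v"
      unfolding inner_matrix_vector_transpose[of x X] inner_matrix_vector_transpose[of w A] w by simp
    also have "\<dots> = x \<bullet> ((Y - X ** transpose X) *v x)"
      by (simp add: matrix_vector_mult_diff_rdistrib inner_diff_right inner_matrix_vector_transpose[of x X]
          flip: matrix_vector_mul_assoc)
    finally show ?thesis .
  qed
  moreover have "Y - X ** transpose X \<in> sym_mats"
    using Y sym_mats_mult_transpose by (rule subspace_diff[OF subspace_sym_mats])
  ultimately show ?thesis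
    by (simp add: G_le_zero_iff psd_def)
qed

section \<open>Convexity of \<open>G\<close> in the Loewner order\<close>

lemma G_convexity_gap:
  assumes "u + v = 1"
  shows "u *\<^sub>R G P Y + v *\<^sub>R G Q W - G (u *\<^sub>R P + v *\<^sub>R Q) (u *\<^sub>R Y + v *\<^sub>R W) =
    (u * v) *\<^sub>R ((P - Q) ** transpose (P - Q))"
proof -
  have v: "v = 1 - u"
    using assms by simp
  \<comment> \<open>Entry (i, j) pairs row i with row j, so the scalar identity is needed with
    independent \<open>p\<close> and \<open>p'\<close>. The terms in \<open>Y\<close> and
    \<open>W\<close> are linear and cancel.\<close>
  have "u * (p * p') + v * (q * q') - (u * p + v * q) * (u * p' + v * q') = u * v * ((p - q) * (p' - q'))"
    for p p' q q' :: real
    unfolding v by algebra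
  then have "u * (\<Sum>k\<in>UNIV. P $ i $ k * P $ j $ k) + v * (\<Sum>k\<in>UNIV. Q $ i $ k * Q $ j $ k) -
      (\<Sum>k\<in>UNIV. (u * P $ i $ k + v * Q $ i $ k) * (u * P $ j $ k + v * Q $ j $ k)) =
      u * v * (\<Sum>k\<in>UNIV. (P $ i $ k - Q $ i $ k) * (P $ j $ k - Q $ j $ k))" for i j
    by (simp add: sum_distrib_left flip: sum.distrib sum_subtractf)
  then show ?thesis
    by (simp add: G_def vec_eq_iff matrix_matrix_mult_def transpose_def algebra_simps)
qed

lemma loewner_convex_G: "loewner_convex_on (UNIV \<times> sym_mats) (\<lambda>(P, Y). G P Y)"
proof -
  have "convex (UNIV \<times> sym_mats)"
    by (intro convex_Times convex_UNIV subspace_imp_convex subspace_sym_mats)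
  then show ?thesis
    by (auto simp: loewner_convex_on_def loewner_le_def G_convexity_gap intro!: psd_scaleR psd_mult_transpose)
qed


subsection \<open>The feasible set\<close>

text \<open>Normal form with parameters (X, Y): the corner of \<open>Y - P P^T\<close> vanishes, so
  the off-diagonal block is forced. The other descriptions are compared with this one.\<close>

lemma feasible_G_iff:
  "(P, M) \<in> feasible_G A \<longleftrightarrow> (\<exists>X Y. P = stack_rows X A \<and>
     M = sym_block Y (A ** transpose X) (A ** transpose A) \<and> Y \<in> sym_mats \<and> G X Y \<preceq> 0)"
proof
  assume "(P, M) \<in> feasible_G A"
  then have M: "M \<in> sym_mats" "G P M \<preceq> 0" "block22 M = A ** transpose A" "bot_rows P = A"
    by (simp_all add: feasible_G_def)
  obtain X where X: "P = stack_rows X A"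
    using M(4) by (metis stack_rows_cases)
  have eq: "M = sym_block (block11 M) (block21 M) (A ** transpose A)"
    using sym_block_blocks[OF M(1)] M(3) by simp
  then have "G X (block11 M) \<preceq> 0" "block21 M = A ** transpose X"
    using M(2) unfolding X by (metis G_stack_rows_le_zero_iff)+
  moreover have "block11 M \<in> sym_mats"
    using M(1) eq by (metis sym_mats_sym_block)
  ultimately show "\<exists>X Y. P = stack_rows X A \<and>
     M = sym_block Y (A ** transpose X) (A ** transpose A) \<and> Y \<in> sym_mats \<and> G X Y \<preceq> 0"
    using X eq by metis
qed (auto simp: feasible_G_def G_stack_rows_le_zero_iff sym_mats_mult_transpose)

text \<open>Forwards, \<open>X\<close> is read off the off-diagonal block by the pseudoinverse.
  Backwards, semidefiniteness first factors that block through \<open>A\<close>, and the Schur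
  complement then gives \<open>G X (block11 M) \<preceq> 0\<close>.\<close>

lemma feasible_G_iff_psd:
  fixes A :: "real^'r^'m"
  assumes rank: "rank A = CARD('r)"
  shows "(P, M) \<in> feasible_G A \<longleftrightarrow> psd M \<and> block22 M = A ** transpose A \<and>
    P = stack_rows (transpose (block21 M) ** A ** matrix_inv (transpose A ** A)) A"
    (is "_ \<longleftrightarrow> ?R")
proof
  assume "(P, M) \<in> feasible_G A"
  then obtain X Y where eq: "P = stack_rows X A" "M = sym_block Y (A ** transpose X) (A ** transpose A)"
    and "G P M \<preceq> 0"
    unfolding feasible_G_iff by (auto simp: G_stack_rows_le_zero_iff)
  then show ?R
    using G_le_zero_imp_psd gram_inv_cancel[OF rank, of X] by (auto simp: matrix_transpose_mul)
next
  assume R: ?R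
  define X where "X = transpose (block21 M) ** A ** matrix_inv (transpose A ** A)"
  have eq: "M = sym_block (block11 M) (block21 M) (A ** transpose A)"
    using sym_block_blocks[of M] R psd_sym by metis
  then have C: "block21 M = A ** transpose X"
    using R rank unfolding X_def by (metis psd_block22_gram_factor)
  with eq have eq': "M = sym_block (block11 M) (A ** transpose X) (A ** transpose A)"
    by simp
  then have "G X (block11 M) \<preceq> 0"
    using R rank by (metis psd_imp_G_le_zero)
  moreover have "block11 M \<in> sym_mats"
    using R eq by (metis psd_sym sym_mats_sym_block)
  ultimately show "(P, M) \<in> feasible_G A"
    using R eq' by (auto simp: feasible_G_iff simp flip: X_def)
qed

text \<open>Symmetry of \<open>M\<close> lets the three block equations determine it, as the upper
  right block is not mentioned.\<close>

lemma feasible_G_iff_blocks: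
  "(P, M) \<in> feasible_G A \<longleftrightarrow> M \<in> sym_mats \<and>
    (\<exists>X Y. Y \<in> sym_mats \<and> G X Y \<preceq> 0 \<and> block11 M = Y \<and> block21 M = A ** transpose X \<and>
       block22 M = A ** transpose A \<and> P = stack_rows X A)"
  unfolding feasible_G_iff
  by (auto simp: sym_mats_mult_transpose) (metis sym_block_blocks)

text \<open>Both facially reduced descriptions are instances of a factorisation \<open>A = B K\<close>: there
  \<open>(X, K)\<close> plays the role of \<open>P\<close> for the small matrix \<open>Z\<close>.\<close>

lemma feasible_G_congruence:
  fixes A :: "real^'r^'m" and B :: "real^'s^'m" and K :: "real^'r^'s"
  assumes rank: "rank A = CARD('r)" and A: "A = B ** K"
  shows "(P, M) \<in> feasible_G A \<longleftrightarrow> (\<exists>X Z. psd Z \<and>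
      M = block_diag (mat 1) B ** Z ** transpose (block_diag (mat 1) B) \<and>
      block22 Z = K ** transpose K \<and> block21 Z = K ** transpose X \<and>
      P = stack_rows X A)"
    (is "_ \<longleftrightarrow> ?R")
proof
  assume "(P, M) \<in> feasible_G A"
  then obtain X Y where eq: "P = stack_rows X A" "M = sym_block Y (A ** transpose X) (A ** transpose A)"
    and Y: "Y \<in> sym_mats" "G X Y \<preceq> 0"
    unfolding feasible_G_iff by auto
  define Z where "Z = sym_block Y (K ** transpose X) (K ** transpose K)"
  have "G (stack_rows X K) Z \<preceq> 0"
    using Y by (simp add: Z_def G_stack_rows_le_zero_iff)
  then have "psd Z"
    by (rule G_le_zero_imp_psd)
  moreover have "M = block_diag (mat 1) B ** Z ** transpose (block_diag (mat 1) B)"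
    unfolding block_diag_congruence[OF psd_sym[OF \<open>psd Z\<close>]]
    by (simp add: Z_def eq A matrix_transpose_mul matrix_mul_assoc)
  ultimately show ?R
    using eq(1) by (intro exI[of _ X] exI[of _ Z]) (simp add: Z_def)
next
  assume ?R
  then obtain X Z where R: "psd Z"
      "M = block_diag (mat 1) B ** Z ** transpose (block_diag (mat 1) B)"
      "block22 Z = K ** transpose K" "block21 Z = K ** transpose X" "P = stack_rows X A"
    by blast
  have M: "M = sym_block (block11 Z) (A ** transpose X) (A ** transpose A)"
    using R block_diag_congruence[OF psd_sym[OF R(1)], of B]
    by (simp add: A matrix_transpose_mul matrix_mul_assoc)
  \<comment> \<open>Semidefiniteness passes from \<open>Z\<close> to \<open>M\<close>, and the Schur
    complement argument is applied to \<open>M\<close>, whose lower block is built from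
    \<open>A\<close> of full column rank.\<close>
  moreover have "psd M"
    using R by (simp add: psd_congruence)
  ultimately have "G X (block11 Z) \<preceq> 0" "block11 Z \<in> sym_mats"
    using psd_imp_G_le_zero[OF _ rank] psd_sym[of M] by auto
  then show "(P, M) \<in> feasible_G A"
    unfolding feasible_G_iff using M R(5) by blast
qed

text \<open>The congruence gives block21 M = B K X^T = A X^T, so the pseudoinverse formula for
  \<open>X\<close> follows from the other conditions and can be adjoined.\<close>

lemma feasible_G_congruence_explicit:
  fixes A :: "real^'r^'m" and B :: "real^'s^'m" and K :: "real^'r^'s"
  assumes rank: "rank A = CARD('r)" and A: "A = B ** K"
  shows "(P, M) \<in> feasible_G A \<longleftrightarrow> (\<exists>X Z. psd Z \<and>
      M = block_diag (mat 1) B ** Z ** transpose (block_diag (mat 1) B) \<and>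
      block22 Z = K ** transpose K \<and>
      X = transpose (block21 M) ** A ** matrix_inv (transpose A ** A) \<and>
      block21 Z = K ** transpose X \<and>
      P = stack_rows X A)"
proof -
  have "X = transpose (block21 M) ** A ** matrix_inv (transpose A ** A)"
    if "psd Z" "M = block_diag (mat 1) B ** Z ** transpose (block_diag (mat 1) B)"
      "block21 Z = K ** transpose X" for X Z
  proof -
    have "block21 M = A ** transpose X"
      using that by (simp add: block_diag_congruence psd_sym A matrix_mul_assoc)
    then show ?thesis
      using gram_inv_cancel[OF rank, of X] by (simp add: matrix_transpose_mul)
  qed
  then show ?thesis
    unfolding feasible_G_congruence[OF assms] by (intro ex_cong1) metis
qed

section \<open>Convexity and closedness of the feasible set\<close>

lemma convex_feasible_G:
  fixes A :: "real^'r^'m"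
  shows "convex (feasible_G A :: ((real^'r^('n::finite + 'm::finite)) \<times> (real^('n + 'm)^('n + 'm))) set)"
proof (rule convexI)
  fix a b :: "(real^'r^('n + 'm)) \<times> (real^('n + 'm)^('n + 'm))" and u v :: real
  assume ab: "a \<in> feasible_G A" "b \<in> feasible_G A" and uv: "0 \<le> u" "0 \<le> v" "u + v = 1"
  obtain P Y Q W where eq: "a = (P, Y)" "b = (Q, W)"
    by (metis surj_pair)
  note ab = ab[unfolded eq feasible_G_def, simplified]
  have gap: "psd (u *\<^sub>R G P Y + v *\<^sub>R G Q W - G (u *\<^sub>R P + v *\<^sub>R Q) (u *\<^sub>R Y + v *\<^sub>R W))"
    using uv by (simp add: G_convexity_gap psd_scaleR psd_mult_transpose)
  have "psd (u *\<^sub>R (0 - G P Y) + v *\<^sub>R (0 - G Q W))"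
    using ab uv unfolding loewner_le_def by (intro psd_add psd_scaleR) auto
  \<comment> \<open>The values of \<open>G\<close> at the two endpoints cancel, leaving its negative
    at the combined point.\<close>
  from psd_add[OF gap this] have "psd (0 - G (u *\<^sub>R P + v *\<^sub>R Q) (u *\<^sub>R Y + v *\<^sub>R W))"
    by (simp add: algebra_simps)
  moreover have "u *\<^sub>R Y + v *\<^sub>R W \<in> sym_mats"
    using ab by (intro subspace_add subspace_scale subspace_sym_mats) auto
  moreover have "block22 (u *\<^sub>R Y + v *\<^sub>R W) = u *\<^sub>R block22 Y + v *\<^sub>R block22 W"
    "bot_rows (u *\<^sub>R P + v *\<^sub>R Q) = u *\<^sub>R bot_rows P + v *\<^sub>R bot_rows Q"
    by (simp_all add: block22_def bot_rows_def vec_eq_iff)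
  ultimately show "u *\<^sub>R a + v *\<^sub>R b \<in> feasible_G A"
    using ab uv by (simp add: eq feasible_G_def loewner_le_def flip: scaleR_add_left)
qed

text \<open>Preimages of closed sets under continuous maps, the quadratic one being Y - P P^T,
  intersected with two continuous equations.\<close>

lemma closed_feasible_G: "closed (feasible_G A)"
proof -
  have "feasible_G A = {z. snd z \<in> sym_mats} \<inter> {z. snd z - fst z ** transpose (fst z) \<in> {M. psd M}} \<inter>
      {z. block22 (snd z) = A ** transpose A} \<inter> {z. bot_rows (fst z) = A}"
    by (auto simp: feasible_G_def G_le_zero_iff)
  also have "closed \<dots>"
    by (intro closed_Int closed_Collect_eq closed_vimage[OF closed_sym_mats, unfolded vimage_def]
        closed_vimage[OF closed_psd, unfolded vimage_def])
      (auto simp: matrix_matrix_mult_def transpose_def block22_def bot_rows_def intro!: continuous_intros)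
  finally show ?thesis .
qed

theorem lemma4p2:
  fixes A U :: "real^'r^'m" and \<Sigma> V :: "real^'r^'r"
    and \<F> :: "((real^'r^('n::finite + 'm::finite)) \<times> (real^('n + 'm)^('n + 'm))) set"
  assumes "CARD('m) < CARD('n)" and "CARD('r) < CARD('m)"
    and "transpose A *v 1 = 0"
    and "rank A = CARD('r)"
    and "compact_svd A U \<Sigma> V"
    and "\<F> = feasible_G A"
  shows
    "(\<F> = {(P, Ybar). Ybar \<in> sym_mats \<and>
        (\<exists>(X :: real^'r^'n) (Y :: real^'n^'n). Y \<in> sym_mats \<and>
           G X Y \<preceq> 0 \<and> block11 Ybar = Y \<and> block21 Ybar = A ** transpose X \<and>
           block22 Ybar = A ** transpose A \<and> P = stack_rows X A)}) \<and>
     (\<F> = {(P, Ybar). Ybar \<in> sym_mats \<and>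
        (\<exists>(X :: real^'r^'n) (Z :: real^('n + 'r)^('n + 'r)). Z \<in> sym_mats \<and>
           psd Z \<and>
           Ybar = block_diag (mat 1 :: real^'n^'n) A ** Z
                    ** transpose (block_diag (mat 1 :: real^'n^'n) A) \<and>
           block22 Z = mat 1 \<and> X = transpose (block21 Z) \<and> P = stack_rows X A)}) \<and>
     (\<F> = {(P, Ybar). Ybar \<in> sym_mats \<and>
        (\<exists>(X :: real^'r^'n). psd Ybar \<and> block22 Ybar = A ** transpose A \<and>
           X = transpose (block21 Ybar) ** A ** matrix_inv (transpose A ** A) \<and>
           P = stack_rows X A)}) \<and>
     (\<F> = {(P, Ybar). Ybar \<in> sym_mats \<and>
        (\<exists>(X :: real^'r^'n) (Z :: real^('n + 'r)^('n + 'r)). Z \<in> sym_mats \<and>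
           psd Z \<and>
           Ybar = block_diag (mat 1 :: real^'n^'n) U ** Z
                    ** transpose (block_diag (mat 1 :: real^'n^'n) U) \<and>
           block22 Z = \<Sigma> ** \<Sigma> \<and>
           X = transpose (block21 Ybar) ** A ** matrix_inv (transpose A ** A) \<and>
           X = transpose (block21 Z) ** matrix_inv \<Sigma> ** transpose V \<and>
           P = stack_rows X A)}) \<and>
     (loewner_convex_on (UNIV \<times> sym_mats)
        (\<lambda>(P :: real^'r^('n + 'm), Ybar :: real^('n + 'm)^('n + 'm)). G P Ybar)) \<and>
     (loewner_convex_on (UNIV \<times> sym_mats)
        (\<lambda>(X :: real^'r^'n, Y :: real^'n^'n). G X Y)) \<and>
     closed \<F> \<and>
     convex \<F>"
proof -
  note rank = assms(4)
  \<comment> \<open>The fourth description is the factorisation with B = U and K =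
    \<open>\<Sigma> ** transpose V\<close>.\<close>
  have A: "A = U ** (\<Sigma> ** transpose V)" and inv: "invertible \<Sigma>" and sym: "transpose \<Sigma> = \<Sigma>"
    and V: "transpose V ** V = mat 1" "V ** transpose V = mat 1"
    using assms(5) pos_def_invertible[of \<Sigma>]
    by (auto simp: compact_svd_def matrix_mul_assoc pos_def_def sym_mats_def orthogonal_matrix_def)
  have "\<Sigma> ** transpose V ** transpose (\<Sigma> ** transpose V) = \<Sigma> ** (transpose V ** V) ** \<Sigma>"
    by (simp add: matrix_transpose_mul sym matrix_mul_assoc)
  then have KK: "\<Sigma> ** transpose V ** transpose (\<Sigma> ** transpose V) = \<Sigma> ** \<Sigma>"
    by (simp add: V)
  \<comment> \<open>This K is invertible, so the condition on \<open>block21 Z\<close> can be solved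
    for \<open>X\<close>.\<close>
  have Z21: "C = \<Sigma> ** transpose V ** transpose X \<longleftrightarrow> X = transpose C ** matrix_inv \<Sigma> ** transpose V"
    for C :: "real^'n^'r" and X :: "real^'r^'n"
  proof
    assume "C = \<Sigma> ** transpose V ** transpose X"
    then have "transpose C ** matrix_inv \<Sigma> ** transpose V
        = X ** (V ** (\<Sigma> ** matrix_inv \<Sigma>) ** transpose V)"
      by (simp add: matrix_transpose_mul sym matrix_mul_assoc)
    then show "X = transpose C ** matrix_inv \<Sigma> ** transpose V"
      by (simp add: matrix_inv_cancel inv V)
  next
    assume "X = transpose C ** matrix_inv \<Sigma> ** transpose V"
    then have "X ** V ** \<Sigma> = transpose C ** (matrix_inv \<Sigma> ** (transpose V ** V) ** \<Sigma>)"
      by (simp add: matrix_mul_assoc)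
    then have "transpose (X ** V ** \<Sigma>) = C"
      by (simp add: matrix_inv_cancel inv V)
    then show "C = \<Sigma> ** transpose V ** transpose X"
      by (simp add: matrix_transpose_mul sym matrix_mul_assoc)
  qed
  \<comment> \<open>This and the next fact insert the symmetry conditions that the sets in the
    theorem spell out.\<close>
  have sym_feasible: "(P, M) \<in> \<F> \<longleftrightarrow> M \<in> sym_mats \<and> (P, M) \<in> feasible_G A" for P M
    by (auto simp: assms(6) feasible_G_def)
  have psd: "psd Z \<longleftrightarrow> Z \<in> sym_mats \<and> psd Z" for Z :: "real^('n + 'r)^('n + 'r)"
    using psd_sym by auto
  have 2: "(P, M) \<in> \<F> \<longleftrightarrow> M \<in> sym_mats \<and>
        (\<exists>(X :: real^'r^'n) (Z :: real^('n + 'r)^('n + 'r)). Z \<in> sym_mats \<and>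
           psd Z \<and>
           M = block_diag (mat 1 :: real^'n^'n) A ** Z
                    ** transpose (block_diag (mat 1 :: real^'n^'n) A) \<and>
           block22 Z = mat 1 \<and> X = transpose (block21 Z) \<and> P = stack_rows X A)" for P M
  proof -
    have "block21 Z = transpose X \<longleftrightarrow> X = transpose (block21 Z)"
      for X :: "real^'r^'n" and Z :: "real^('n + 'r)^('n + 'r)"
      by (metis transpose_transpose)
    then show ?thesis
      \<comment> \<open>The trivial factorisation A = A I, with B = A and K = I.\<close>
      unfolding sym_feasible feasible_G_congruence[OF rank matrix_mul_rid[symmetric]]
      by (subst psd) (simp add: transpose_mat)
  qed
  have 3: "(P, M) \<in> \<F> \<longleftrightarrow> M \<in> sym_mats \<and>
        (\<exists>(X :: real^'r^'n). psd M \<and> block22 M = A ** transpose A \<and>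
           X = transpose (block21 M) ** A ** matrix_inv (transpose A ** A) \<and>
           P = stack_rows X A)" for P M
    by (simp add: sym_feasible feasible_G_iff_psd[OF rank])
  have 4: "(P, M) \<in> \<F> \<longleftrightarrow> M \<in> sym_mats \<and>
        (\<exists>(X :: real^'r^'n) (Z :: real^('n + 'r)^('n + 'r)). Z \<in> sym_mats \<and>
           psd Z \<and>
           M = block_diag (mat 1 :: real^'n^'n) U ** Z
                    ** transpose (block_diag (mat 1 :: real^'n^'n) U) \<and>
           block22 Z = \<Sigma> ** \<Sigma> \<and>
           X = transpose (block21 M) ** A ** matrix_inv (transpose A ** A) \<and>
           X = transpose (block21 Z) ** matrix_inv \<Sigma> ** transpose V \<and>
           P = stack_rows X A)" for P M
    unfolding sym_feasible feasible_G_congruence_explicit[OF rank A] KK Z21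
    by (subst psd) (simp only: conj_assoc)
  have set_of_pairs_eqI: "S = {(P, M). Q P M}" if "\<And>P M. (P, M) \<in> S \<longleftrightarrow> Q P M"
    for S :: "((real^'r^('n + 'm)) \<times> (real^('n + 'm)^('n + 'm))) set" and Q
    using that by auto
  show ?thesis
    by (intro conjI set_of_pairs_eqI)
      (rule 2 3 4 loewner_convex_G |
        simp only: assms(6) feasible_G_iff_blocks closed_feasible_G convex_feasible_G)+
qed

end
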